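(* Let $\alpha,\beta>-1$ and $n\ge 0$. Let $x_0<x_1<\dots<x_n$ be the roots of the Jacobi polynomial $P_{n+1}^{(\alpha,\beta)}$, and let $w_0,\dots,w_n$ be the weights of the corresponding $(n+1)$-point Gauss-Jacobi quadrature rule with respect to the weight function $(1-x)^\alpha(1+x)^\beta$ on $[-1,1]$. Then the barycentric weights $\lambda_j=\prod_{k\neq j}(x_j-x_k)^{-1}$ of the nodes $x_0,\dots,x_n$ are $$\lambda_j=C_n^{(\alpha,\beta)}(-1)^j\sqrt{(1-x_j^2)\,w_j},\qquad j=0,\dots,n,$$ where $$C_n^{(\alpha,\beta)}=\sigma\,\frac{\Gamma(2n+\alpha+\beta+3)}{2^{\,n+1+\frac{\alpha+\beta+1}{2}}}\,\frac{1}{\sqrt{(n+1)!\,\Gamma(n+\alpha+\beta+2)\,\Gamma(n+\alpha+2)\,\Gamma(n+\beta+2)}},$$ with $\sigma=+1$ for even $n$ and $\sigma=-1$ for odd $n$. In particular, simplified barycentric weights for these nodes are $(-1)^j\sqrt{(1-x_j^2)w_j}$, $j=0,\dots,n$.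
   Context: The Gaussian quadrature rule $\int_{-1}^1(1-x)^\alpha(1+x)^\beta f(x)\,dx\simeq\sum_{j=0}^nw_jf(x_j)$ is exact for all polynomials of degree at most $2n+1$. Simplified barycentric weights are any numbers obtained from the barycentric weights $\lambda_0,\dots,\lambda_n$ by dividing all of them by a common nonzero factor independent of $j$. *)

theory Defs
  imports "HOL-Analysis.Analysis" "HOL-Computational_Algebra.Polynomial"
begin

(* P_n^{(a,b)}(t) = (a+1)_n / n! * 2F1(-n, n+a+b+1; a+1; (1-t)/2), with the standard
   normalisation P_n^{(a,b)}(1) = (a+1)_n / n!.  The terminating series is meaningful
   whenever a is not a negative integer, in particular for a > -1. *)
definition jacobi_poly :: "real \<Rightarrow> real \<Rightarrow> nat \<Rightarrow> real poly" where
  "jacobi_poly a b n =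
     smult (pochhammer (a + 1) n / fact n)
       (\<Sum>m\<le>n. smult (pochhammer (- real n) m * pochhammer (real n + a + b + 1) m
                       / (pochhammer (a + 1) m * fact m))
                  ([:1/2, -1/2:] ^ m))"

(* Only x 0, ..., x n and w 0, ..., w n matter.  At t = -1 and t = 1 the integrand
   takes a conventional finite value (0 powr c = 0), which does not affect the integral. *)
definition gauss_jacobi_rule ::
    "real \<Rightarrow> real \<Rightarrow> nat \<Rightarrow> (nat \<Rightarrow> real) \<Rightarrow> (nat \<Rightarrow> real) \<Rightarrow> bool" where
  "gauss_jacobi_rule a b n x w \<longleftrightarrow>
     (\<forall>p :: real poly. degree p \<le> 2 * n + 1 \<longrightarrow>
        ((\<lambda>t. (1 - t) powr a * (1 + t) powr b * poly p t)
           has_integral (\<Sum>j\<le>n. w j * poly p (x j))) {-1..1})"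

definition barycentric_weight :: "nat \<Rightarrow> (nat \<Rightarrow> real) \<Rightarrow> nat \<Rightarrow> real" where
  "barycentric_weight n x j = (\<Prod>k\<in>{..n} - {j}. inverse (x j - x k))"

definition simplified_barycentric_weights ::
    "nat \<Rightarrow> (nat \<Rightarrow> real) \<Rightarrow> (nat \<Rightarrow> real) \<Rightarrow> bool" where
  "simplified_barycentric_weights n x v \<longleftrightarrow>
     (\<exists>c. c \<noteq> 0 \<and> (\<forall>j\<le>n. v j = barycentric_weight n x j / c))"

definition jacobi_barycentric_const :: "real \<Rightarrow> real \<Rightarrow> nat \<Rightarrow> real" where
  "jacobi_barycentric_const a b n =
     (if even n then 1 else -1)
     * (Gamma (2 * real n + a + b + 3) / 2 powr (real n + 1 + (a + b + 1) / 2))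
     * (1 / sqrt (fact (n + 1) * Gamma (real n + a + b + 2)
                  * Gamma (real n + a + 2) * Gamma (real n + b + 2)))"

end

theory Submission
  imports Defs
begin

text \<open>
  Write J for integration against the Jacobi weight, p for the monic polynomial with
  roots x_0, ..., x_n, and l = p / (t - x_j), so that p'(x_j) = l(x_j) is the reciprocal of
  the j-th barycentric weight. Exactness of the rule makes p orthogonal to all
  polynomials of degree at most n. The polynomial r = (1 - t^2) p' + (n + 1) t p has degree
  at most n + 1, so the rule is exact for r l and gives
  J(r l) = w_j (1 - x_j^2) p'(x_j)^2. On the other hand, integration by parts turns J(r l)
  into J(p s) with deg s = n + 1, which by orthogonality is the leading coefficient
  2n + a + b + 3 of s times J(p^2). Hence (1 - x_j^2) w_j is a constant multiple of the
  squared barycentric weight. Finally J(p^2) is found by pairing the Jacobi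
  polynomial with (1 + t)^(n+1): the terms are Beta integrals, and their sum is an instance of
  the Chu-Vandermonde identity.
\<close>

section \<open>Integration of polynomials against the Jacobi weight\<close>

definition jacobi_weight :: "real \<Rightarrow> real \<Rightarrow> real \<Rightarrow> real" where
  "jacobi_weight a b t = (1 - t) powr a * (1 + t) powr b"

definition jacobi_integral :: "real \<Rightarrow> real \<Rightarrow> real poly \<Rightarrow> real" where
  "jacobi_integral a b p = integral {-1..1} (\<lambda>t. jacobi_weight a b t * poly p t)"

text \<open>The substitution (1 + t)/2 carries the interval to [0, 1] and gives a Beta integral. The
  rescaled powers contribute \<open>2 powr (a + b)\<close>, the substitution itself one more factor
  2.\<close>

lemma has_integral_jacobi_weight:
  assumes "a > -1" "b > -1"
  shows "(jacobi_weight a b has_integral 2 powr (a + b + 1) * Beta (a + 1) (b + 1)) {-1..1}"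
proof -
  have "((\<lambda>t. t powr (b + 1 - 1) * (1 - t) powr (a + 1 - 1)) has_integral Beta (b + 1) (a + 1)) {0..1}"
    using assms by (intro has_integral_Beta_real) auto
  then have "((\<lambda>t. t powr b * (1 - t) powr a) has_integral Beta (b + 1) (a + 1)) (cbox 0 1)"
    by simp
  from has_integral_affinity'[OF this, of "1/2" "1/2"]
  have "((\<lambda>t. (t / 2 + 1 / 2) powr b * (1 - (t / 2 + 1 / 2)) powr a)
          has_integral 2 * Beta (b + 1) (a + 1)) {-1..1}"
    by simp
  from has_integral_mult_right[OF this, of "2 powr (a + b)"]
  have "((\<lambda>t. 2 powr (a + b) * ((t / 2 + 1 / 2) powr b * (1 - (t / 2 + 1 / 2)) powr a))
          has_integral 2 powr (a + b + 1) * Beta (a + 1) (b + 1)) {-1..1}"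
    by (simp add: powr_add Beta_commute mult_ac)
  moreover have "2 powr (a + b) * ((t / 2 + 1 / 2) powr b * (1 - (t / 2 + 1 / 2)) powr a)
      = jacobi_weight a b t" if "t \<in> {-1..1}" for t :: real
  proof -
    have 1: "t / 2 + 1 / 2 = (1 + t) / 2" and 2: "1 - (1 + t) / 2 = (1 - t) / 2"
      by (simp_all add: field_simps)
    have "2 powr (a + b) * ((t / 2 + 1 / 2) powr b * (1 - (t / 2 + 1 / 2)) powr a)
        = 2 powr (a + b) * (((1 + t) / 2) powr b * ((1 - t) / 2) powr a)"
      unfolding 1 2 ..
    also have "\<dots> = jacobi_weight a b t"
      using that by (simp add: jacobi_weight_def powr_divide powr_add)
    finally show ?thesis .
  qed
  ultimately show ?thesis
    by (subst has_integral_cong) auto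
qed

text \<open>Linear factors 1 - t and 1 + t can thus be traded for a larger exponent, which turns
  products of their powers into Beta integrals. On the interval both bases are nonnegative, so
  raising them to \<open>powr\<close> 1 changes nothing.\<close>

lemma jacobi_weight_plus1:
  assumes "t \<in> {-1..1}"
  shows "jacobi_weight (a + 1) b t = (1 - t) * jacobi_weight a b t"
    and "jacobi_weight a (b + 1) t = (1 + t) * jacobi_weight a b t"
  using assms by (auto simp: jacobi_weight_def powr_add)

lemma integrable_jacobi_weight_poly:
  assumes "a > -1" "b > -1"
  shows "(\<lambda>t. jacobi_weight a b t * poly p t) integrable_on {-1..1}"
  using assms
proof (induction p arbitrary: a)
  case 0
  then show ?case by (simp add: integrable_0)
next
  case (pCons c p)
  \<comment> \<open>Since t = 1 - (1 - t), multiplying the weight by t gives the difference of the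
    weights for \<open>a\<close> and \<open>a + 1\<close>. This is why the induction keeps
    \<open>a\<close> arbitrary.\<close>
  have "(\<lambda>t. c * jacobi_weight a b t + (jacobi_weight a b t * poly p t
          - jacobi_weight (a + 1) b t * poly p t)) integrable_on {-1..1}"
    using pCons.prems
    by (intro integrable_add integrable_diff integrable_on_mult_right pCons.IH
          has_integral_integrable[OF has_integral_jacobi_weight]) auto
  then show ?case
    by (rule integrable_eq) (simp add: jacobi_weight_plus1, simp add: algebra_simps)
qed

lemma jacobi_integral_smult:
  "jacobi_integral a b (smult c p) = c * jacobi_integral a b p"
  by (simp add: jacobi_integral_def mult.left_commute)

lemma jacobi_integral_add:
  assumes "a > -1" "b > -1"
  shows "jacobi_integral a b (p + q) = jacobi_integral a b p + jacobi_integral a b q"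
  using assms unfolding jacobi_integral_def
  by (simp add: distrib_left integral_add integrable_jacobi_weight_poly)

lemma jacobi_integral_diff:
  assumes "a > -1" "b > -1"
  shows "jacobi_integral a b (p - q) = jacobi_integral a b p - jacobi_integral a b q"
  using assms unfolding jacobi_integral_def
  by (simp add: right_diff_distrib integral_diff integrable_jacobi_weight_poly)

lemma jacobi_integral_sum:
  assumes "a > -1" "b > -1"
  shows "jacobi_integral a b (\<Sum>i\<in>A. f i) = (\<Sum>i\<in>A. jacobi_integral a b (f i))"
proof (induction A rule: infinite_finite_induct)
  case (insert i A)
  then show ?case using assms by (simp add: jacobi_integral_add)
qed (simp_all add: jacobi_integral_def)

lemma jacobi_integral_power_left:
  "jacobi_integral a b ([:1, -1:] ^ m * p) = jacobi_integral (a + real m) b p"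
proof (induction m arbitrary: a)
  case (Suc m)
  have "jacobi_integral a b ([:1, -1:] ^ Suc m * p)
      = jacobi_integral (a + 1) b ([:1, -1:] ^ m * p)"
    unfolding jacobi_integral_def
    by (rule integral_cong) (simp add: jacobi_weight_plus1, simp add: algebra_simps)
  then show ?case using Suc by (simp add: add_ac)
qed simp

lemma jacobi_integral_power_right:
  "jacobi_integral a b ([:1, 1:] ^ m * p) = jacobi_integral a (b + real m) p"
proof (induction m arbitrary: b)
  case (Suc m)
  have "jacobi_integral a b ([:1, 1:] ^ Suc m * p)
      = jacobi_integral a (b + 1) ([:1, 1:] ^ m * p)"
    unfolding jacobi_integral_def
    by (rule integral_cong) (simp add: jacobi_weight_plus1, simp add: algebra_simps)
  then show ?case using Suc by (simp add: add_ac)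
qed simp

lemma jacobi_integral_powers:
  assumes "a > -1" "b > -1"
  shows "jacobi_integral a b ([:1, -1:] ^ m * [:1, 1:] ^ k)
    = 2 powr (a + b + m + k + 1) * Beta (a + m + 1) (b + k + 1)"
proof -
  have "jacobi_integral a b ([:1, -1:] ^ m * [:1, 1:] ^ k)
      = jacobi_integral (a + m) (b + k) 1"
    using jacobi_integral_power_right[of "a + m" b k 1]
    by (simp add: jacobi_integral_power_left)
  also have "\<dots> = 2 powr (a + b + m + k + 1) * Beta (a + m + 1) (b + k + 1)"
    using integral_unique[OF has_integral_jacobi_weight[of "a + m" "b + k"]] assms
    by (simp add: jacobi_integral_def add_ac)
  finally show ?thesis .
qed

text \<open>The integrand is the derivative of (1 - t)^(a+1) (1 + t)^(b+1) q, which vanishes at both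
  ends. The linear factor is 1 - t^2 times the logarithmic derivative of the two powers.\<close>

lemma jacobi_integral_by_parts:
  assumes "a > -1" "b > -1"
  shows "jacobi_integral a b ([:1, 0, -1:] * pderiv q + [:b - a, -(a + b + 2):] * q) = 0"
proof -
  let ?F = "\<lambda>t. (1 - t) powr (a + 1) * (1 + t) powr (b + 1) * poly q t"
  let ?f = "\<lambda>t. jacobi_weight a b t
      * poly ([:1, 0, -1:] * pderiv q + [:b - a, -(a + b + 2):] * q) t"
  have "(?f has_integral ?F 1 - ?F (-1)) {-1..1}"
  \<comment> \<open>For a negative exponent the weight is unbounded near an endpoint, so the
    derivative is taken in the interior only. Continuity of \<open>?F\<close> up to the ends rests
    on a + 1 and b + 1 being positive.\<close>
  proof (rule fundamental_theorem_of_calculus_interior)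
    show "continuous_on {-1..1} ?F"
      using assms by (intro continuous_intros continuous_on_powr') auto
  next
    fix t :: real assume t: "t \<in> {-1<..<1}"
    have "(?F has_real_derivative
        (-(a + 1) * (1 - t) powr a * (1 + t) powr (b + 1)
         + (1 - t) powr (a + 1) * ((b + 1) * (1 + t) powr b)) * poly q t
        + (1 - t) powr (a + 1) * (1 + t) powr (b + 1) * poly (pderiv q) t) (at t)"
      using t by (auto intro!: derivative_eq_intros simp: algebra_simps)
    also have "(-(a + 1) * (1 - t) powr a * (1 + t) powr (b + 1)
         + (1 - t) powr (a + 1) * ((b + 1) * (1 + t) powr b)) * poly q t
        + (1 - t) powr (a + 1) * (1 + t) powr (b + 1) * poly (pderiv q) t = ?f t"
      using t by (simp add: jacobi_weight_def powr_add algebra_simps)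
    finally show "(?F has_vector_derivative ?f t) (at t)"
      by (simp add: has_real_derivative_iff_has_vector_derivative)
  qed simp
  then show ?thesis
    unfolding jacobi_integral_def by (simp add: integral_unique)
qed


text \<open>Subtracting \<open>coeff q N\<close> times \<open>p\<close> from \<open>q\<close> leaves
  a polynomial of degree below \<open>N\<close>, which orthogonality kills.\<close>

lemma jacobi_integral_monic_orthogonal:
  assumes "a > -1" "b > -1" "degree p = N" "lead_coeff p = 1" "N > 0"
    and orth: "\<And>q. degree q < N \<Longrightarrow> jacobi_integral a b (p * q) = 0"
    and "degree q \<le> N"
  shows "jacobi_integral a b (p * q) = coeff q N * jacobi_integral a b (p * p)"
proof -
  define r where "r = q - smult (coeff q N) p"
  have "degree r \<le> N"
    using assms unfolding r_def by (intro degree_diff_le) auto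
  moreover have "coeff r N = 0"
    using assms by (simp add: r_def)
  \<comment> \<open>Degree exactly \<open>N\<close> with vanishing coefficient there would make
    \<open>r\<close> zero and hence \<open>N\<close> zero.\<close>
  ultimately have "degree r < N"
    using \<open>N > 0\<close> by (metis degree_0 le_neq_implies_less leading_coeff_0_iff)
  then have "jacobi_integral a b (p * r) = 0"
    by (rule orth)
  moreover have "p * q = smult (coeff q N) (p * p) + p * r"
    by (simp add: r_def algebra_simps)
  ultimately show ?thesis
    using assms by (simp add: jacobi_integral_add jacobi_integral_smult)
qed

lemma gauss_jacobi_rule_integral:
  assumes "gauss_jacobi_rule a b n x w" "degree p \<le> 2 * n + 1"
  shows "jacobi_integral a b p = (\<Sum>j\<le>n. w j * poly p (x j))"
  using assms unfolding gauss_jacobi_rule_def jacobi_integral_def jacobi_weight_def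
  by (intro integral_unique) blast

section \<open>The node polynomial and the quadrature weights\<close>

definition node_poly :: "nat \<Rightarrow> (nat \<Rightarrow> real) \<Rightarrow> real poly" where
  "node_poly n x = (\<Prod>k\<le>n. [:- x k, 1:])"

lemma degree_node_poly: "degree (node_poly n x) = Suc n"
  by (simp add: node_poly_def degree_prod_eq_sum_degree)

lemma lead_coeff_node_poly: "lead_coeff (node_poly n x) = 1"
  by (simp add: node_poly_def lead_coeff_prod)

lemma poly_node_poly_eq_0_iff: "poly (node_poly n x) t = 0 \<longleftrightarrow> t \<in> x ` {..n}"
  by (auto simp: node_poly_def poly_prod)

text \<open>The product has degree at most (n + 1) + n, just within the exactness of the rule, and
  vanishes at every node.\<close>

lemma gauss_jacobi_rule_orthogonal:
  assumes "gauss_jacobi_rule a b n x w" "degree q \<le> n"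
  shows "jacobi_integral a b (node_poly n x * q) = 0"
proof -
  have "degree (node_poly n x * q) \<le> 2 * n + 1"
    using degree_mult_le[of "node_poly n x" q] assms(2) by (simp add: degree_node_poly)
  moreover have "poly (node_poly n x) (x j) = 0" if "j \<le> n" for j
    using that by (simp add: poly_node_poly_eq_0_iff)
  ultimately show ?thesis
    using gauss_jacobi_rule_integral[OF assms(1)] by simp
qed

lemma gauss_jacobi_weight_barycentric:
  assumes ab: "a > -1" "b > -1" and inj: "inj_on x {..n}"
    and rule: "gauss_jacobi_rule a b n x w" and j: "j \<le> n"
  shows "(1 - (x j)\<^sup>2) * w j
    = (2 * real n + a + b + 3) * jacobi_integral a b (node_poly n x * node_poly n x)
        * (barycentric_weight n x j)\<^sup>2"
proof -
  define p where "p = node_poly n x"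
  define l where "l = (\<Prod>k\<in>{..n} - {j}. [:- x k, 1:])"
  define h where "h = jacobi_integral a b (p * p)"
  have p_eq: "p = [:- x j, 1:] * l"
    using j unfolding p_def l_def node_poly_def by (subst prod.remove[of _ j]) auto
  have degp: "degree p = Suc n" and lcp: "coeff p (Suc n) = 1"
    using degree_node_poly[of n x] lead_coeff_node_poly[of n x] by (auto simp: p_def)
  have degl: "degree l = n"
    using j by (simp add: l_def degree_prod_eq_sum_degree)
  have lcl: "coeff l n = 1"
    using lead_coeff_prod[of "\<lambda>k. [:- x k, 1:]" "{..n} - {j}"] degl by (simp add: l_def)
  have coeff_p: "coeff p i = 0" if "i > Suc n" for i
    using that degp by (simp add: coeff_eq_0)
  have coeff_l: "coeff l i = 0" if "i > n" for i
    using that degl by (simp add: coeff_eq_0)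
  have p_j: "poly p (x j) = 0" and p'_j: "poly (pderiv p) (x j) = poly l (x j)"
    unfolding p_eq pderiv_mult by (simp_all add: pderiv_pCons del: mult_pCons_left)
  have l_i: "poly l (x i) = 0" if "i \<le> n" "i \<noteq> j" for i
    using that by (auto simp: l_def poly_prod)
  have l_j: "poly l (x j) * barycentric_weight n x j = 1"
  proof -
    have "x j - x k \<noteq> 0" if "k \<in> {..n} - {j}" for k
      using inj j that by (auto dest: inj_onD)
    then show ?thesis
      by (simp add: l_def poly_prod barycentric_weight_def flip: prod.distrib)
  qed

  define r where "r = [:1, 0, -1:] * pderiv p + [:0, real (Suc n):] * p"
  \<comment> \<open>\<open>s\<close> is the cofactor of \<open>p\<close> left when the integrand of
    the integration by parts for \<open>l * p\<close> is subtracted from \<open>r * l\<close>; the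
    terms with \<open>pderiv p\<close> cancel.\<close>
  define s where "s = [:0, real (Suc n):] * l - [:1, 0, -1:] * pderiv l
      - [:b - a, -(a + b + 2):] * l"
  \<comment> \<open>The leading terms of the two summands of r cancel, which brings the
    degree of r l within the exactness of the rule.\<close>
  have "degree r \<le> Suc n"
  proof (rule degree_le, intro allI impI)
    fix i assume "Suc n < i"
    then obtain i' where "i = Suc (Suc i')" "n \<le> i'"
      by (metis Suc_leI Suc_le_D Suc_le_mono)
    then show "coeff r i = 0"
      by (cases "i' = n") (simp_all add: r_def coeff_pderiv coeff_p lcp algebra_simps del: of_nat_Suc)
  qed
  then have "degree (r * l) \<le> 2 * n + 1"
    using degree_mult_le[of r l] degl by linarith
  then have "jacobi_integral a b (r * l) = (\<Sum>i\<le>n. w i * poly (r * l) (x i))"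
    by (rule gauss_jacobi_rule_integral[OF rule])
  \<comment> \<open>\<open>l\<close> vanishes at all other nodes. At the remaining one
    \<open>p\<close> vanishes and its derivative equals \<open>l\<close>, which yields the square in
    the next step.\<close>
  also have "\<dots> = w j * poly (r * l) (x j)"
    using j l_i by (subst sum.remove[of _ j]) auto
  also have "\<dots> = (1 - (x j)\<^sup>2) * w j * (poly l (x j))\<^sup>2"
    by (simp add: r_def p_j p'_j power2_eq_square algebra_simps)
  finally have *: "jacobi_integral a b (r * l) = (1 - (x j)\<^sup>2) * w j * (poly l (x j))\<^sup>2" .

  have "r * l = p * s + ([:1, 0, -1:] * pderiv (l * p) + [:b - a, -(a + b + 2):] * (l * p))"
    unfolding r_def s_def pderiv_mult by algebra
  then have "jacobi_integral a b (r * l) = jacobi_integral a b (p * s)"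
    using jacobi_integral_by_parts[OF ab]
    by (simp only: jacobi_integral_add[OF ab, of "p * s"] add_0_right)
  also have "\<dots> = coeff s (Suc n) * h"
    unfolding h_def
  proof (rule jacobi_integral_monic_orthogonal)
    show "jacobi_integral a b (p * q) = 0" if "degree q < Suc n" for q
      using that gauss_jacobi_rule_orthogonal[OF rule] by (simp add: p_def)
    show "degree s \<le> Suc n"
    proof (rule degree_le, intro allI impI)
      fix i assume "Suc n < i"
      then obtain i' where "i = Suc (Suc i')" "n \<le> i'"
        by (metis Suc_leI Suc_le_D Suc_le_mono)
      then show "coeff s i = 0"
        by (simp add: s_def coeff_pderiv coeff_l)
    qed
  qed (use ab degp lcp in auto)
  \<comment> \<open>The three terms of \<open>s\<close> contribute n + 1, n and a + b + 2; the
    middle one comes from t^2 times the derivative of the monic \<open>l\<close>.\<close>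
  also have "coeff s (Suc n) = 2 * real n + a + b + 3"
    using lcl by (cases n) (simp_all add: s_def coeff_pderiv coeff_l algebra_simps)
  finally have "(1 - (x j)\<^sup>2) * w j * (poly l (x j))\<^sup>2 = (2 * real n + a + b + 3) * h"
    using * by simp
  then have "(1 - (x j)\<^sup>2) * w j * (poly l (x j))\<^sup>2 * (barycentric_weight n x j)\<^sup>2
      = (2 * real n + a + b + 3) * h * (barycentric_weight n x j)\<^sup>2"
    by simp
  moreover have "(poly l (x j))\<^sup>2 * (barycentric_weight n x j)\<^sup>2 = 1"
    using l_j by (simp flip: power_mult_distrib)
  ultimately show ?thesis
    by (simp add: h_def p_def mult.assoc)
qed

section \<open>The leading coefficient of the Jacobi polynomial and its pairing with (1 +
  t)^N\<close>

lemma degree_jacobi_poly_le: "degree (jacobi_poly a b N) \<le> N"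
proof -
  have "degree ([:1/2, -1/2::real:] ^ m) \<le> N" if "m \<le> N" for m
    using that by (simp add: degree_power_eq)
  then show ?thesis
    unfolding jacobi_poly_def
    by (intro order.trans[OF degree_smult_le] degree_sum_le)
       (auto intro: order.trans[OF degree_smult_le])
qed

text \<open>Only the summand m = N reaches degree N. Its sign from
  \<open>pochhammer (- real N) N\<close> cancels that of (-1/2)^N, and the positive factor
  \<open>pochhammer (a + 1) N\<close> cancels against the normalisation.\<close>

lemma coeff_jacobi_poly_top:
  assumes "a > -1"
  shows "coeff (jacobi_poly a b N) N = pochhammer (real N + a + b + 1) N / (2 ^ N * fact N)"
proof -
  define d where "d m = pochhammer (- real N) m * pochhammer (real N + a + b + 1) m
                       / (pochhammer (a + 1) m * fact m)" for m
  have "coeff (jacobi_poly a b N) N = pochhammer (a + 1) N / fact N *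
      (\<Sum>m\<le>N. d m * coeff ([:1/2, -1/2:] ^ m) N)"
    by (simp add: jacobi_poly_def coeff_sum d_def)
  also have "(\<Sum>m\<le>N. d m * coeff ([:1/2, -1/2:] ^ m) N)
      = (\<Sum>m\<in>{N}. d m * coeff ([:1/2, -1/2:] ^ m) N)"
    by (rule sum.mono_neutral_right) (auto simp: degree_power_eq intro!: coeff_eq_0)
  also have "\<dots> = d N * (-1/2) ^ N"
    using lead_coeff_power[of "[:1/2, -1/2::real:]" N] by (simp add: degree_power_eq)
  finally have "coeff (jacobi_poly a b N) N = pochhammer (a + 1) N / fact N * (d N * (-1/2) ^ N)" .
  moreover have "pochhammer (a + 1) N > 0"
    using assms by (intro pochhammer_pos) auto
  moreover have "pochhammer (- real N) N = (-1) ^ N * fact N"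
    by (rule pochhammer_same)
  ultimately have "coeff (jacobi_poly a b N) N
      = pochhammer (real N + a + b + 1) N * ((-1) ^ N * (-1/2) ^ N) / fact N"
    by (simp add: d_def)
  also have "(-1) ^ N * (-1/2) ^ N = (1 / 2 ^ N :: real)"
    by (simp add: power_divide flip: power_mult_distrib)
  finally show ?thesis
    by simp
qed

lemma pochhammer_Gamma_pos:
  fixes z :: real
  assumes "z > 0"
  shows "Gamma (z + real m) = pochhammer z m * Gamma z" "Gamma z > 0"
proof -
  have "z \<notin> \<int>\<^sub>\<le>\<^sub>0"
    using assms by (auto dest: nonpos_Ints_nonpos)
  then show "Gamma z > 0" "Gamma (z + real m) = pochhammer z m * Gamma z"
    using assms by (auto simp: pochhammer_Gamma Gamma_real_pos Gamma_eq_zero_iff)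
qed

lemma jacobi_integral_jacobi_poly_power:
  assumes "a > -1" "b > -1"
  shows "jacobi_integral a b (jacobi_poly a b N * [:1, 1:] ^ N)
    = 2 powr (a + b + real N + 1) * Gamma (a + real N + 1) * Gamma (b + real N + 1)
        / Gamma (a + b + 2 * real N + 2)"
proof -
  \<comment> \<open>\<open>c\<close> is the sum of the Beta arguments a + 1 and b + N + 1 for m = 0,
    and \<open>K\<close> is the integral of (1 + t)^N. Further factors 1 - t only add Pochhammer
    symbols and a power of 2 that cancels the halves in the series.\<close>
  define c where "c = a + b + real N + 2"
  define d where "d m = pochhammer (- real N) m * pochhammer (real N + a + b + 1) m
                       / (pochhammer (a + 1) m * fact m)" for m
  define K where "K = 2 powr (a + b + real N + 1) * Gamma (a + 1) * Gamma (b + real N + 1) / Gamma c"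
  have c: "c > 0"
    using assms by (simp add: c_def)
  have term_eq: "d m / 2 ^ m * jacobi_integral a b ([:1, -1:] ^ m * [:1, 1:] ^ N)
      = K * (pochhammer (real N + a + b + 1) m * pochhammer (- real N) m
           / (fact m * pochhammer c m))" for m
  proof -
    have "Gamma (a + real m + 1) = pochhammer (a + 1) m * Gamma (a + 1)"
      using assms pochhammer_Gamma_pos(1)[of "a + 1" m] by (simp add: add_ac)
    moreover have "Gamma (a + real m + 1 + (b + real N + 1)) = pochhammer c m * Gamma c"
      using pochhammer_Gamma_pos(1)[OF c, of m] by (simp add: c_def add_ac)
    moreover have "2 powr (a + b + real m + real N + 1) = 2 powr (a + b + real N + 1) * 2 ^ m"
      by (simp add: powr_add powr_realpow)
    ultimately have "jacobi_integral a b ([:1, -1:] ^ m * [:1, 1:] ^ N)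
        = 2 powr (a + b + real N + 1) * 2 ^ m
          * (pochhammer (a + 1) m * Gamma (a + 1) * Gamma (b + real N + 1) / (pochhammer c m * Gamma c))"
      using assms by (simp only: jacobi_integral_powers Beta_def)
    moreover have "pochhammer (a + 1) m > 0"
      using assms by (intro pochhammer_pos) auto
    ultimately show ?thesis
      by (simp add: d_def K_def mult_ac)
  qed
  have "[:1/2, -1/2:] ^ m = smult (1 / 2 ^ m) ([:1, -1::real:] ^ m)" for m
    using smult_power[of "1/2" "[:1, -1::real:]" m] by (simp add: power_divide)
  then have "jacobi_poly a b N * [:1, 1:] ^ N = smult (pochhammer (a + 1) N / fact N)
      (\<Sum>m\<le>N. smult (d m / 2 ^ m) ([:1, -1:] ^ m * [:1, 1:] ^ N))"
    by (simp add: jacobi_poly_def d_def sum_distrib_right)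
  then have "jacobi_integral a b (jacobi_poly a b N * [:1, 1:] ^ N)
      = pochhammer (a + 1) N / fact N *
        (\<Sum>m\<le>N. d m / 2 ^ m * jacobi_integral a b ([:1, -1:] ^ m * [:1, 1:] ^ N))"
    using assms by (simp only: jacobi_integral_smult jacobi_integral_sum)
  also have "\<dots> = pochhammer (a + 1) N / fact N * (K *
      (\<Sum>m=0..N. pochhammer (real N + a + b + 1) m * pochhammer (- real N) m
           / (of_nat (fact m) * pochhammer c m)))"
    by (simp only: term_eq sum_distrib_left atLeast0AtMost of_nat_fact)
  also have "(\<Sum>m=0..N. pochhammer (real N + a + b + 1) m * pochhammer (- real N) m
           / (of_nat (fact m) * pochhammer c m))
      = pochhammer (c - (real N + a + b + 1)) N / pochhammer c N"
    using c by (intro Vandermonde_pochhammer) auto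
  \<comment> \<open>This gap of 1 makes the Chu-Vandermonde numerator equal to N!, which cancels the
    factorial in the normalisation.\<close>
  also have "c - (real N + a + b + 1) = 1"
    by (simp add: c_def)
  also have "pochhammer (a + 1) N / fact N * (K * (pochhammer 1 N / pochhammer c N))
      = 2 powr (a + b + real N + 1) * (pochhammer (a + 1) N * Gamma (a + 1)) * Gamma (b + real N + 1)
        / (pochhammer c N * Gamma c)"
    by (simp add: K_def mult_ac flip: pochhammer_fact)
  also have "pochhammer (a + 1) N * Gamma (a + 1) = Gamma (a + real N + 1)"
    using assms pochhammer_Gamma_pos(1)[of "a + 1" N] by (simp add: add_ac)
  also have "pochhammer c N * Gamma c = Gamma (a + b + 2 * real N + 2)"
    using pochhammer_Gamma_pos(1)[OF c, of N] by (simp add: c_def add_ac)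
  finally show ?thesis .
qed

section \<open>Sign of the barycentric weights, norm of the node polynomial, and the
  constant\<close>

lemma barycentric_weight_sign:
  assumes "strict_mono_on {..n} x" "j \<le> n"
  shows "barycentric_weight n x j = (-1) ^ (n - j) * \<bar>barycentric_weight n x j\<bar>"
proof -
  have "barycentric_weight n x j
      = (\<Prod>k\<in>{..n} - {j}. (if j < k then -1 else 1) * \<bar>inverse (x j - x k)\<bar>)"
    unfolding barycentric_weight_def
  proof (rule prod.cong)
    fix k assume k: "k \<in> {..n} - {j}"
    then have "j < k \<or> k < j" by auto
    then show "inverse (x j - x k) = (if j < k then -1 else 1) * \<bar>inverse (x j - x k)\<bar>"
      using k assms strict_mono_onD[OF assms(1), of j k] strict_mono_onD[OF assms(1), of k j]
      by (auto simp: abs_if)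
  qed simp
  also have "\<dots> = (\<Prod>k\<in>{..n} - {j}. if j < k then -1 else 1) * \<bar>barycentric_weight n x j\<bar>"
    by (simp add: prod.distrib barycentric_weight_def abs_prod)
  \<comment> \<open>Negative factors come from the nodes to the right of \<open>x j\<close>, of
    which there are n - j.\<close>
  also have "(\<Prod>k\<in>{..n} - {j}. if j < k then -1 else 1 :: real) = (\<Prod>k\<in>{j<..n}. -1)"
    by (rule prod.mono_neutral_cong_right) auto
  finally show ?thesis by simp
qed

lemma jacobi_integral_node_poly_square:
  assumes ab: "a > -1" "b > -1" and inj: "inj_on x {..n}"
    and roots: "x ` {..n} = {t. poly (jacobi_poly a b (n + 1)) t = 0}"
    and rule: "gauss_jacobi_rule a b n x w"
  shows "jacobi_integral a b (node_poly n x * node_poly n x)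
    = 2 powr (2 * real n + a + b + 3) * fact (n + 1) * Gamma (real n + a + b + 2)
        * Gamma (real n + a + 2) * Gamma (real n + b + 2)
        / (Gamma (2 * real n + a + b + 4) * Gamma (2 * real n + a + b + 3))"
proof -
  define p where "p = node_poly n x"
  define k where "k = coeff (jacobi_poly a b (n + 1)) (n + 1)"
  define z where "z = real n + a + b + 2"
  have z: "z > 0"
    using ab by (simp add: z_def)
  have P_eq: "jacobi_poly a b (n + 1) = smult k p"
  \<comment> \<open>With equal coefficients at n + 1 the difference has degree at most n, yet it
    vanishes at n + 1 distinct nodes.\<close>
  proof (rule poly_eqI_degree_lead_coeff[where n = "n + 1" and A = "x ` {..n}"])
    show "coeff (jacobi_poly a b (n + 1)) (n + 1) = coeff (smult k p) (n + 1)"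
      using lead_coeff_node_poly[of n x] by (simp add: degree_node_poly k_def p_def)
    show "n + 1 \<le> card (x ` {..n})"
      using inj by (simp add: card_image)
    show "degree (smult k p) \<le> n + 1"
      using degree_smult_le[of k p] by (simp add: degree_node_poly p_def)
    show "poly (jacobi_poly a b (n + 1)) t = poly (smult k p) t" if "t \<in> x ` {..n}" for t
      using that roots poly_node_poly_eq_0_iff[of n x t] by (auto simp: p_def)
  qed (rule degree_jacobi_poly_le)
  have "k = pochhammer z (n + 1) / (2 ^ (n + 1) * fact (n + 1))"
    using ab coeff_jacobi_poly_top[of a b "n + 1"] by (simp add: k_def z_def add_ac)
  moreover have "Gamma (2 * real n + a + b + 3) = pochhammer z (n + 1) * Gamma z"
    using pochhammer_Gamma_pos(1)[OF z, of "n + 1"] by (simp add: z_def add_ac)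
  ultimately have k: "k = Gamma (2 * real n + a + b + 3) / (2 ^ (n + 1) * fact (n + 1) * Gamma z)"
    using pochhammer_Gamma_pos(2)[OF z] by simp
  have Gamma_pos: "Gamma (2 * real n + a + b + 3) > 0" "Gamma (2 * real n + a + b + 4) > 0"
    "Gamma z > 0"
    using ab z by (auto intro!: pochhammer_Gamma_pos(2))
  \<comment> \<open>(1 + t)^(n+1) is monic of degree n + 1, so its pairing with \<open>p\<close> is
    the squared norm of \<open>p\<close>; times \<open>k\<close> this is the pairing with the Jacobi
    polynomial, known in closed form.\<close>
  have "jacobi_integral a b (p * [:1, 1:] ^ (n + 1))
      = coeff ([:1, 1:] ^ (n + 1)) (n + 1) * jacobi_integral a b (p * p)"
  proof (rule jacobi_integral_monic_orthogonal)
    show "jacobi_integral a b (p * q) = 0" if "degree q < n + 1" for q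
      using that gauss_jacobi_rule_orthogonal[OF rule] by (simp add: p_def)
    show "degree ([:1, 1::real:] ^ (n + 1)) \<le> n + 1"
      by (subst degree_power_eq) auto
  qed (use ab degree_node_poly[of n x] lead_coeff_node_poly[of n x] in \<open>auto simp: p_def\<close>)
  also have "coeff ([:1, 1::real:] ^ (n + 1)) (n + 1) = 1"
    using lead_coeff_power[of "[:1, 1::real:]" "n + 1"] by (subst (asm) degree_power_eq) auto
  finally have "k * jacobi_integral a b (p * p)
      = jacobi_integral a b (jacobi_poly a b (n + 1) * [:1, 1:] ^ (n + 1))"
    by (simp only: P_eq mult_smult_left jacobi_integral_smult mult_1)
  also have "\<dots> = 2 powr (real n + a + b + 2) * Gamma (real n + a + 2) * Gamma (real n + b + 2)
      / Gamma (2 * real n + a + b + 4)"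
    using ab jacobi_integral_jacobi_poly_power[of a b "n + 1"] by (simp add: add_ac)
  finally have "jacobi_integral a b (p * p) = 2 powr (real n + a + b + 2) * Gamma (real n + a + 2)
      * Gamma (real n + b + 2) / Gamma (2 * real n + a + b + 4)
      * (2 ^ (n + 1) * fact (n + 1) * Gamma z) / Gamma (2 * real n + a + b + 3)"
    using Gamma_pos by (simp add: k divide_simps mult_ac del: fact_Suc power_Suc)
  moreover have "2 powr (2 * real n + a + b + 3) = 2 powr (real n + a + b + 2) * 2 ^ (n + 1)"
    by (simp add: algebra_simps flip: powr_realpow powr_add del: power_Suc)
  ultimately show ?thesis
    by (simp add: p_def z_def mult_ac del: fact_Suc power_Suc)
qed

text \<open>Identifies the explicit constant, up to sign, with the factor between weights and square
  roots. The recurrence Gamma(u + 1) = u Gamma(u) at u = 2n + a + b + 3 absorbs the linear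
  factor.\<close>

lemma jacobi_barycentric_const_square:
  assumes "a > -1" "b > -1"
  shows "(jacobi_barycentric_const a b n)\<^sup>2 * ((2 * real n + a + b + 3)
    * (2 powr (2 * real n + a + b + 3) * fact (n + 1) * Gamma (real n + a + b + 2)
        * Gamma (real n + a + 2) * Gamma (real n + b + 2)
        / (Gamma (2 * real n + a + b + 4) * Gamma (2 * real n + a + b + 3)))) = 1"
proof -
  define D where "D = fact (n + 1) * Gamma (real n + a + b + 2)
    * Gamma (real n + a + 2) * Gamma (real n + b + 2)"
  define G where "G = Gamma (2 * real n + a + b + 3)"
  define T where "T = 2 powr (2 * real n + a + b + 3)"
  define u where "u = 2 * real n + a + b + 3"
  have D: "D > 0"
    unfolding D_def using assms by (intro mult_pos_pos pochhammer_Gamma_pos(2)) auto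
  have u: "u > 0" and G: "G > 0"
    unfolding u_def G_def using assms by (auto intro!: pochhammer_Gamma_pos(2))
  have T: "T > 0"
    by (simp add: T_def)
  have "(2 powr (real n + 1 + (a + b + 1) / 2))\<^sup>2 = (2::real) powr (2 * (real n + 1 + (a + b + 1) / 2))"
    by (simp only: power2_eq_square mult_2 flip: powr_add)
  also have "2 * (real n + 1 + (a + b + 1) / 2) = 2 * real n + a + b + 3"
    by simp
  finally have "(jacobi_barycentric_const a b n)\<^sup>2 = G\<^sup>2 / (T * D)"
    using D unfolding jacobi_barycentric_const_def D_def[symmetric] G_def[symmetric]
    by (simp add: power_mult_distrib power_divide T_def)
  moreover have "Gamma (2 * real n + a + b + 4) = u * G"
    using pochhammer_Gamma_pos(1)[OF u, of 1] by (simp add: u_def G_def add_ac)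
  moreover have "2 powr (2 * real n + a + b + 3) * fact (n + 1) * Gamma (real n + a + b + 2)
        * Gamma (real n + a + 2) * Gamma (real n + b + 2) = T * D"
    by (simp add: T_def D_def mult_ac)
  moreover have "Gamma u = G"
    by (simp add: u_def G_def)
  ultimately show ?thesis
    using D u G T unfolding u_def[symmetric] G_def[symmetric]
    by (simp only:) (simp add: power2_eq_square)
qed

theorem corollary3:
  fixes \<alpha> \<beta> :: real and n :: nat and x w :: "nat \<Rightarrow> real"
  assumes "\<alpha> > -1" and "\<beta> > -1"
    and "strict_mono_on {..n} x"
    and "x ` {..n} = {t. poly (jacobi_poly \<alpha> \<beta> (n + 1)) t = 0}"
    and "gauss_jacobi_rule \<alpha> \<beta> n x w"
  shows "(\<forall>j\<le>n. barycentric_weight n x j =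
            jacobi_barycentric_const \<alpha> \<beta> n * (-1) ^ j * sqrt ((1 - (x j)\<^sup>2) * w j))
         \<and> simplified_barycentric_weights n x (\<lambda>j. (-1) ^ j * sqrt ((1 - (x j)\<^sup>2) * w j))"
proof -
  define C where "C = jacobi_barycentric_const \<alpha> \<beta> n"
  \<comment> \<open>\<open>K\<close> is the ratio of (1 - x_j^2) w_j to the squared barycentric
    weight, the same for all j.\<close>
  define K where "K = (2 * real n + \<alpha> + \<beta> + 3)
    * jacobi_integral \<alpha> \<beta> (node_poly n x * node_poly n x)"
  have inj: "inj_on x {..n}"
    using assms(3) by (rule strict_mono_on_imp_inj_on)
  have CK: "C\<^sup>2 * K = 1"
    using jacobi_barycentric_const_square[OF assms(1,2), of n]
      jacobi_integral_node_poly_square[OF assms(1,2) inj assms(4,5)]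
    by (simp only: C_def K_def)
  then have C: "C \<noteq> 0"
    by auto
  have C_sign: "C = (-1) ^ n * \<bar>C\<bar>"
  proof -
    have "Gamma (2 * real n + \<alpha> + \<beta> + 3) > 0" "Gamma (real n + \<alpha> + \<beta> + 2) > 0"
      "Gamma (real n + \<alpha> + 2) > 0" "Gamma (real n + \<beta> + 2) > 0"
      using assms(1,2) by (auto intro!: pochhammer_Gamma_pos(2))
    then show ?thesis
      by (simp add: C_def jacobi_barycentric_const_def abs_mult)
  qed
  have weight: "barycentric_weight n x j = C * (-1) ^ j * sqrt ((1 - (x j)\<^sup>2) * w j)"
    if j: "j \<le> n" for j
  proof -
    define u where "u = barycentric_weight n x j"
    have "(1 - (x j)\<^sup>2) * w j = K * u\<^sup>2"
      using gauss_jacobi_weight_barycentric[OF assms(1,2) inj assms(5) j] by (simp add: K_def u_def)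
    moreover have "K = (1 / C)\<^sup>2"
      using CK C by (simp add: power_divide field_simps)
    ultimately have "sqrt ((1 - (x j)\<^sup>2) * w j) = \<bar>u\<bar> / \<bar>C\<bar>"
      by (simp add: real_sqrt_mult power_divide real_sqrt_divide)
    then have "C * (-1) ^ j * sqrt ((1 - (x j)\<^sup>2) * w j) = C / \<bar>C\<bar> * (-1) ^ j * \<bar>u\<bar>"
      by simp
    also have "C / \<bar>C\<bar> = (-1) ^ n"
      using C C_sign by (metis abs_eq_0 nonzero_mult_div_cancel_right)
    \<comment> \<open>The exponents n + j and n - j differ by the even number 2j; the alternating
      sign thus meets the sign of the barycentric weight.\<close>
    also have "(-1) ^ n * (-1) ^ j = ((-1) ^ (n - j) :: real)"
      using j by (simp add: minus_one_power_iff)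
    also have "(-1) ^ (n - j) * \<bar>u\<bar> = u"
      using barycentric_weight_sign[OF assms(3) j] by (simp add: u_def)
    finally show ?thesis
      by (simp add: u_def)
  qed
  moreover have "simplified_barycentric_weights n x (\<lambda>j. (-1) ^ j * sqrt ((1 - (x j)\<^sup>2) * w j))"
    unfolding simplified_barycentric_weights_def
    using C weight by (intro exI[of _ C]) (simp add: field_simps)
  ultimately show ?thesis
    by (simp add: C_def)
qed

end
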